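(* Let $p\ge7$ be a prime and let $A=\{a_1,a_2\}\subseteq\mathbf{F}_p^{\ast}$ with $a_1\ne a_2$. Let $G=(\mathbf{F}_p,E_A)$ be the Cayley graph with $E_A=\{(x,x+a):x\in\mathbf{F}_p,\ a\in A\}$. If $G$ is triangle-free, then \[ \beta(G)\le\frac{p-1}{2}\le\frac{\gamma(G)}{2}. \]
   Context: $\mathbf{F}_p=\mathbf{Z}/p\mathbf{Z}$, $\mathbf{F}_p^\ast=\mathbf{F}_p\setminus\{0\}$. In a directed graph $(V,E)$ with $E\subseteq V\times V$, a directed cycle of length $n\ge1$ is a sequence of vertices $w_0,\ldots,w_n$ with $(w_j,w_{j+1})\in E$ for all $j$ and $w_n=w_0$; loops, digons and triangles are directed cycles of length 1, 2, 3 respectively. The graph is triangle-free (3-free) if it has no loop, digon or triangle, and directed acyclic if it has no directed cycle. $\beta(G)$ is the minimum size of a set $X$ of edges such that $(V,E\setminus X)$ is directed acyclic. $\gamma(G)$ is the number of unordered pairs of distinct vertices that are nonadjacent in the undirected graph obtained from $G$ by replacing each directed edge by an undirected edge. *)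

theory Defs
  imports "HOL-Number_Theory.Residues" "Graph_Theory.Pair_Digraph"
begin

text \<open>
  Vertices of a directed cycle may repeat: cycles are closed walks, unlike the cycles of
  the Graph_Theory library. Only \<open>w 0, \<dots>, w n\<close> are relevant.
\<close>

definition directed_cycle :: "'a pair_pre_digraph \<Rightarrow> nat \<Rightarrow> (nat \<Rightarrow> 'a) \<Rightarrow> bool" where
  "directed_cycle G n w \<longleftrightarrow>
     n \<ge> 1 \<and> (\<forall>j\<le>n. w j \<in> pverts G) \<and>
     (\<forall>j<n. (w j, w (Suc j)) \<in> parcs G) \<and> w n = w 0"

definition directed_acyclic :: "'a pair_pre_digraph \<Rightarrow> bool" where
  "directed_acyclic G \<longleftrightarrow> \<not> (\<exists>n w. directed_cycle G n w)"

text \<open>Loops and digons are excluded as well.\<close>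

definition triangle_free :: "'a pair_pre_digraph \<Rightarrow> bool" where
  "triangle_free G \<longleftrightarrow> \<not> (\<exists>n\<in>{1, 2, 3}. \<exists>w. directed_cycle G n w)"

text \<open>
  The minimum is attained whenever \<open>parcs G\<close> is finite, since then \<open>X = parcs G\<close> qualifies.
\<close>

definition beta :: "'a pair_pre_digraph \<Rightarrow> nat" where
  "beta G = (LEAST k. \<exists>X. X \<subseteq> parcs G \<and> finite X \<and> card X = k \<and>
     directed_acyclic (G\<lparr>parcs := parcs G - X\<rparr>))"

definition gamma :: "'a pair_pre_digraph \<Rightarrow> nat" where
  "gamma G = card {{u, v} | u v. u \<in> pverts G \<and> v \<in> pverts G \<and> u \<noteq> v \<and>
     (u, v) \<notin> parcs G \<and> (v, u) \<notin> parcs G}"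

text \<open>The Cayley graph of the additive group of a ring.\<close>

definition cayley_digraph :: "('a, 'b) ring_scheme \<Rightarrow> 'a set \<Rightarrow> 'a pair_pre_digraph" where
  "cayley_digraph R A =
     \<lparr>pverts = carrier R, parcs = {(x, x \<oplus>\<^bsub>R\<^esub> a) | x a. x \<in> carrier R \<and> a \<in> A}\<rparr>"

end

theory Submission
  imports Defs
begin

text \<open>
  Dilate the group by some \<open>t \<noteq> 0\<close> and order the vertices by \<open>t x mod p\<close>. The arcs
  \<open>(x, x + a)\<close> that fail to increase are those that wrap around, and there are
  \<open>t a mod p\<close> of them; deleting them for both generators leaves an acyclic graph. So it suffices
  to find \<open>t\<close> with \<open>(t a1 mod p) + (t a2 mod p) < p / 2\<close>. Normalising \<open>a1 = 1\<close> and \<open>a2 = c\<close>,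
  triangle-freeness excludes \<open>c = -1, -2, -1/2\<close>. If \<open>c < p / 2\<close>, then \<open>t = 1\<close> works; otherwise
  \<open>c = p - b\<close> with \<open>3 \<le> b < p / 2\<close>, and \<open>t = p div b\<close> works because then \<open>t c mod p = p mod b\<close>.
  The bound on \<open>\<gamma>\<close> is the count \<open>p (p - 1) / 2 - 2 p \<ge> p - 1\<close>.
\<close>

text \<open>Along a closed walk \<open>f\<close> would strictly increase and yet return to its
  starting value.\<close>

lemma directed_acyclic_if_increasing:
  fixes f :: "'a \<Rightarrow> 'b::order"
  assumes "\<And>u v. (u, v) \<in> parcs G \<Longrightarrow> f u < f v"
  shows "directed_acyclic G"
  unfolding directed_acyclic_def
proof
  assume "\<exists>n w. directed_cycle G n w"
  then obtain n w where n: "n \<ge> 1" and arcs: "\<And>j. j < n \<Longrightarrow> (w j, w (Suc j)) \<in> parcs G"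
    and closed: "w n = w 0"
    by (auto simp: directed_cycle_def)
  have "f (w 0) < f (w (Suc m))" if "m < n" for m
    using that
  proof (induction m)
    case 0
    then show ?case using assms arcs by blast
  next
    case (Suc m)
    then have "f (w 0) < f (w (Suc m))" by simp
    also have "\<dots> < f (w (Suc (Suc m)))" using assms arcs Suc.prems by blast
    finally show ?case .
  qed
  from this[of "n - 1"] n closed show False by simp
qed

lemma beta_le_card_non_increasing:
  fixes f :: "'a \<Rightarrow> 'b::order"
  assumes "finite (parcs G)"
  shows "beta G \<le> card {(u, v) \<in> parcs G. \<not> f u < f v}"
proof -
  let ?X = "{(u, v) \<in> parcs G. \<not> f u < f v}"
  have "directed_acyclic (G\<lparr>parcs := parcs G - ?X\<rparr>)"
    by (rule directed_acyclic_if_increasing[of _ f]) auto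
  moreover have "?X \<subseteq> parcs G" by auto
  moreover from this have "finite ?X" using assms finite_subset by blast
  ultimately show ?thesis
    unfolding beta_def by (intro Least_le exI[of _ ?X]) auto
qed

text \<open>As \<open>t\<close> is a unit modulo \<open>p\<close>, the labels
  \<open>t * x mod p\<close> are distinct. A label fails to increase only when adding
  \<open>t * a mod p\<close> wraps around, which forces it into the top \<open>t * a mod p\<close>
  residues.\<close>

lemma card_non_increasing_translates_le:
  fixes p t a :: int
  assumes p: "p > 0" and t: "coprime t p" and a: "\<not> p dvd a"
  shows "int (card {x \<in> {0..p - 1}. \<not> t * x mod p < t * ((x + a) mod p) mod p}) \<le> t * a mod p"
proof -
  let ?f = "\<lambda>x. t * x mod p"
  let ?X = "{x \<in> {0..p - 1}. \<not> ?f x < ?f ((x + a) mod p)}"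
  have pos: "t * a mod p > 0"
  proof -
    have "\<not> p dvd t * a"
      using t a by (simp add: coprime_commute coprime_dvd_mult_right_iff)
    then show ?thesis
      using p by (metis dvd_eq_mod_eq_0 le_less pos_mod_sign)
  qed
  have "inj_on ?f {0..p - 1}"
  proof (rule inj_onI)
    fix x y assume xy: "x \<in> {0..p - 1}" "y \<in> {0..p - 1}" and "?f x = ?f y"
    then have "[x = y] (mod p)"
      using t cong_mult_lcancel unfolding cong_def by blast
    with xy show "x = y" by (simp add: cong_def)
  qed
  then have "inj_on ?f ?X" by (rule inj_on_subset) auto
  moreover have "?f ` ?X \<subseteq> {p - t * a mod p..p - 1}"
  proof
    fix y assume "y \<in> ?f ` ?X"
    then obtain x where y: "y = ?f x" and x: "\<not> ?f x < ?f ((x + a) mod p)" by auto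
    have eq: "?f ((x + a) mod p) = (?f x + t * a mod p) mod p"
      by (simp add: mod_simps distrib_left)
    \<comment> \<open>Below \<open>p\<close> no reduction would occur, and the label would grow by
      the positive amount \<open>t * a mod p\<close>.\<close>
    have "?f x + t * a mod p \<ge> p"
    proof (rule ccontr)
      assume "\<not> ?thesis"
      with p have "(?f x + t * a mod p) mod p = ?f x + t * a mod p" by simp
      with eq x pos show False by linarith
    qed
    moreover have "?f x < p" using p by simp
    ultimately show "y \<in> {p - t * a mod p..p - 1}" using y by simp
  qed
  ultimately have "card ?X \<le> card {p - t * a mod p..p - 1}"
    by (rule card_inj_on_le) simp
  also have "\<dots> = nat (t * a mod p)" by simp
  finally show ?thesis using pos by linarith
qed

lemma parcs_cayley_residue_ring:
  "parcs (cayley_digraph (residue_ring m) A) = (\<lambda>(x, a). (x, (x + a) mod m)) ` ({0..m - 1} \<times> A)"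
  by (auto simp: cayley_digraph_def residue_ring_def)

lemma beta_cayley_residue_ring_le:
  fixes p t a b :: int
  assumes p: "p > 0" and t: "coprime t p" and ab: "\<not> p dvd a" "\<not> p dvd b"
  shows "int (beta (cayley_digraph (residue_ring p) {a, b})) \<le> t * a mod p + t * b mod p"
proof -
  let ?G = "cayley_digraph (residue_ring p) {a, b}"
  let ?f = "\<lambda>x. t * x mod p"
  let ?D = "\<lambda>c. {x \<in> {0..p - 1}. \<not> ?f x < ?f ((x + c) mod p)}"
  let ?e = "\<lambda>c x. (x, (x + c) mod p)"
  have "beta ?G \<le> card {(u, v) \<in> parcs ?G. \<not> ?f u < ?f v}"
    by (rule beta_le_card_non_increasing) (simp add: parcs_cayley_residue_ring)
  also have "{(u, v) \<in> parcs ?G. \<not> ?f u < ?f v} = ?e a ` ?D a \<union> ?e b ` ?D b"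
    unfolding parcs_cayley_residue_ring by auto
  also have "card \<dots> \<le> card (?e a ` ?D a) + card (?e b ` ?D b)" by (rule card_Un_le)
  also have "\<dots> \<le> card (?D a) + card (?D b)"
    by (intro add_mono card_image_le finite_subset[of "?D _" "{0..p - 1}"]) auto
  finally show ?thesis
    using card_non_increasing_translates_le[OF p t ab(1)]
      card_non_increasing_translates_le[OF p t ab(2)] by linarith
qed

text \<open>The partial sums of the generators, starting at 0, form a walk; it closes up as soon as
  the total is divisible by \<open>m\<close>. Repeated generators are allowed, so relations such as
  \<open>a + a + b\<close> are covered.\<close>

lemma triangle_free_residue_ring:
  fixes m a b c :: int
  assumes tf: "triangle_free (cayley_digraph (residue_ring m) A)" and m: "m > 0"
    and A: "a \<in> A" "b \<in> A" "c \<in> A"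
  shows "\<not> m dvd a + b" and "\<not> m dvd a + b + c"
proof -
  let ?G = "cayley_digraph (residue_ring m) A"
  have V: "x mod m \<in> pverts ?G" for x
    using m by (simp add: cayley_digraph_def residue_ring_def)
  have E: "(x mod m, (x + y) mod m) \<in> parcs ?G" if "y \<in> A" for x y
    unfolding parcs_cayley_residue_ring using that m
    by (auto intro!: image_eqI[of _ _ "(x mod m, y)"] simp: mod_simps)
  show "\<not> m dvd a + b"
  proof
    assume "m dvd a + b"
    then have "directed_cycle ?G 2 (\<lambda>j. [0, a, a + b] ! j mod m)"
      using V E[of a 0] E[of b a] A by (auto simp: directed_cycle_def numeral_eq_Suc less_Suc_eq)
    with tf show False unfolding triangle_free_def by blast
  qed
  show "\<not> m dvd a + b + c"
  proof
    assume "m dvd a + b + c"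
    then have "directed_cycle ?G 3 (\<lambda>j. [0, a, a + b, a + b + c] ! j mod m)"
      using V E[of a 0] E[of b a] E[of c "a + b"] A
      by (auto simp: directed_cycle_def numeral_eq_Suc less_Suc_eq)
    with tf show False unfolding triangle_free_def by blast
  qed
qed

text \<open>Here \<open>c\<close> stands for the ratio of the two generators; the bounds exclude the
  residues 0, 1, -1, -2, and the last condition excludes -1/2.\<close>

lemma ex_small_dilation_of_one:
  fixes p c :: int
  assumes p: "p \<ge> 7" "odd p" and c: "2 \<le> c" "c \<le> p - 3" "2 * c + 1 \<noteq> p"
  shows "\<exists>r. 0 < r \<and> r < p \<and> 2 * (r + r * c mod p) < p"
proof (cases "2 * c + 1 < p")
  case True
  \<comment> \<open>Both sides of \<open>2 * c + 1 < p\<close> are odd, so they differ by at least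
    2.\<close>
  then have "2 * (1 + c) < p" using p(2) by presburger
  with p c show ?thesis by (intro exI[of _ 1]) simp
next
  case False
  define b r s where "b = p - c" and "r = p div b" and "s = p mod b"
  have b: "3 \<le> b" "2 * b \<le> p" using False c by (auto simp: b_def)
  have prs: "p = r * b + s" by (simp add: r_def s_def)
  have s: "0 \<le> s" "s < b" using b by (auto simp: s_def)
  have r: "2 \<le> r" unfolding r_def
    using b zdiv_mono1[of "2 * b" p b] by simp
  have "r * b \<ge> r * 3" using b r by (intro mult_left_mono) auto
  then have "r < p" using prs r s by linarith
  have "r * c = s + (r - 1) * p" using prs by (simp add: b_def algebra_simps)
  then have "r * c mod p = s mod p" by simp
  also have "\<dots> = s" using s b by simp
  finally have rc: "r * c mod p = s" .
  have "2 * (r + s) < p"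
  \<comment> \<open>For \<open>b = 3\<close> the claim amounts to \<open>s < r\<close>. As
    \<open>s \<le> 2 \<le> r\<close>, only \<open>r = s = 2\<close> could violate it, and that means
    \<open>p = 8\<close>, which is even.\<close>
  proof (cases "b = 3")
    case True
    then show ?thesis using prs s r p by presburger
  next
    case False
    with b have "4 \<le> b" by simp
    \<comment> \<open>The gap \<open>p - 2 * (r + s)\<close> equals
      \<open>r * (b - 2) + 2 * b - 2 * b - s\<close>, that is \<open>r * b - 2 * r - s\<close>; with
      \<open>s \<le> b - 1\<close> it is at least \<open>b - 3\<close>, hence positive.\<close>
    have "2 * (b - 2) \<le> r * (b - 2)" using b r by (intro mult_right_mono) auto
    also have "r * (b - 2) = r * b - 2 * r" by (simp add: algebra_simps)
    finally show ?thesis using prs s \<open>4 \<le> b\<close> by simp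
  qed
  then show ?thesis using rc r \<open>r < p\<close> by (intro exI[of _ r]) auto
qed

text \<open>Dividing by the unit \<open>a\<close> turns the generators into 1 and
  \<open>c = b / a\<close>; a dilation \<open>r\<close> that works for these gives
  \<open>t = r / a\<close>.\<close>

lemma ex_small_dilation:
  fixes p a b :: int
  assumes p: "prime p" "p \<ge> 7" and ab: "\<not> p dvd a" "\<not> p dvd b" "\<not> p dvd a - b"
    and tf: "\<not> p dvd a + b" "\<not> p dvd a + a + b" "\<not> p dvd a + b + b"
  shows "\<exists>t. coprime t p \<and> 2 * (t * a mod p + t * b mod p) < p"
proof -
  have "coprime a p"
    using p ab by (metis coprime_commute prime_imp_coprime)
  then obtain u where u: "[a * u = 1] (mod p)"
    using cong_solve_coprime_int by blast
  define c where "c = u * b mod p"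
  have cu: "[a * c = b] (mod p)"
  proof -
    have "[a * c = a * (u * b)] (mod p)"
      unfolding c_def by (simp add: cong_def mod_simps)
    also have "a * (u * b) = (a * u) * b" by simp
    also have "[\<dots> = 1 * b] (mod p)" using u by (rule cong_scalar_right)
    finally show ?thesis by simp
  qed
  have dvd_iff: "p dvd x * a + y * b \<longleftrightarrow> p dvd x + y * c" for x y
  proof -
    have "[x * a + y * b = x * a + y * (a * c)] (mod p)"
      using cu by (intro cong_add cong_mult) (auto simp: cong_sym)
    also have "x * a + y * (a * c) = a * (x + y * c)" by (simp add: algebra_simps)
    finally have "p dvd x * a + y * b \<longleftrightarrow> p dvd a * (x + y * c)"
      by (rule cong_dvd_iff)
    then show ?thesis
      using p ab(1) by (simp add: prime_dvd_mult_iff)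
  qed
  have c: "0 \<le> c" "c < p" using p by (auto simp: c_def)
  \<comment> \<open>Each excluded relation between \<open>a\<close> and \<open>b\<close> becomes an
    excluded value of \<open>c\<close>: in order 0, 1, -1, -2, -1/2.\<close>
  have "\<not> p dvd c" "\<not> p dvd 1 - c" "\<not> p dvd 1 + c" "\<not> p dvd 2 + c" "\<not> p dvd 1 + 2 * c"
    using dvd_iff[of 0 1] dvd_iff[of 1 "-1"] dvd_iff[of 1 1] dvd_iff[of 2 1] dvd_iff[of 1 2] ab tf
    by (simp_all add: algebra_simps)
  then have "c \<noteq> 0" "c \<noteq> 1" "1 + c \<noteq> p" "2 + c \<noteq> p" "2 * c + 1 \<noteq> p"
    by (auto simp: add.commute)
  moreover have "odd p" using p prime_odd_int[of p] by simp
  ultimately obtain r where r: "0 < r" "r < p" "2 * (r + r * c mod p) < p"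
    using ex_small_dilation_of_one[of p c] p c by force
  have "[r * u * a = r * 1] (mod p)"
    using cong_scalar_left[OF u, of r] by (simp add: ac_simps)
  then have 1: "r * u * a mod p = r" using r by (simp add: cong_def)
  have 2: "r * u * b mod p = r * c mod p"
    by (simp add: c_def mod_simps ac_simps)
  have "\<not> p dvd r * u" using 1 r dvd_mult2[of p "r * u" a] by auto
  then have "coprime (r * u) p"
    using p by (metis coprime_commute prime_imp_coprime)
  with 1 2 r show ?thesis by (intro exI[of _ "r * u"]) simp
qed

text \<open>Every pair of distinct vertices is either nonadjacent or of the form
  \<open>{x, x + a}\<close> modulo \<open>p\<close>, and there are at most \<open>p * card A\<close>
  of the latter. The additive form avoids truncated subtraction.\<close>

lemma gamma_cayley_residue_ring_ge:
  fixes A :: "int set"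
  assumes A: "finite A"
  shows "p choose 2 \<le> gamma (cayley_digraph (residue_ring (int p)) A) + p * card A"
proof -
  let ?G = "cayley_digraph (residue_ring (int p)) A"
  let ?V = "{0..int p - 1}"
  let ?N = "{{u, v} | u v. u \<in> pverts ?G \<and> v \<in> pverts ?G \<and> u \<noteq> v \<and>
     (u, v) \<notin> parcs ?G \<and> (v, u) \<notin> parcs ?G}"
  let ?E = "(\<lambda>(x, a). {x, (x + a) mod int p}) ` (?V \<times> A)"
  have V: "pverts ?G = ?V" by (simp add: cayley_digraph_def residue_ring_def)
  have "{B. B \<subseteq> ?V \<and> card B = 2} \<subseteq> ?N \<union> ?E"
  proof
    fix B assume "B \<in> {B. B \<subseteq> ?V \<and> card B = 2}"
    then obtain u v where B: "B = {u, v}" "u \<noteq> v" "u \<in> ?V" "v \<in> ?V"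
      by (auto simp: card_2_iff)
    show "B \<in> ?N \<union> ?E"
    proof (cases "(u, v) \<in> parcs ?G \<or> (v, u) \<in> parcs ?G")
      case True
      then have "B \<in> ?E"
        unfolding parcs_cayley_residue_ring B(1) by (auto simp: image_iff insert_commute)
      then show ?thesis by blast
    next
      case False
      with B have "B \<in> ?N" unfolding V by blast
      then show ?thesis by blast
    qed
  qed
  moreover have "finite ?N"
    by (rule finite_subset[of _ "Pow ?V"]) (auto simp: V)
  moreover have "finite ?E" using A by simp
  ultimately have "card {B. B \<subseteq> ?V \<and> card B = 2} \<le> card (?N \<union> ?E)"
    by (intro card_mono) auto
  also have "\<dots> \<le> card ?N + card ?E" by (rule card_Un_le)
  also have "card ?E \<le> card (?V \<times> A)" using A by (intro card_image_le) simp
  also have "card (?V \<times> A) = p * card A" by (simp add: card_cartesian_product)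
  finally show ?thesis by (simp add: n_subsets gamma_def)
qed

theorem theorem4:
  fixes p :: nat and a1 a2 :: int and A :: "int set" and G :: "int pair_pre_digraph"
  assumes "prime p" and "p \<ge> 7"
    and "A = {a1, a2}" and "a1 \<noteq> a2"
    and "A \<subseteq> carrier (residue_ring (int p)) - {\<zero>\<^bsub>residue_ring (int p)\<^esub>}"
    and "G = cayley_digraph (residue_ring (int p)) A"
    and "triangle_free G"
  shows "real (beta G) \<le> (real p - 1) / 2 \<and> (real p - 1) / 2 \<le> real (gamma G) / 2"
proof
  have p: "prime (int p)" "int p \<ge> 7" "int p > 0" using assms(1,2) by auto
  have range: "0 < a1" "a1 < int p" "0 < a2" "a2 < int p"
    using assms(3,5) by (auto simp: residue_ring_def)
  then have ndvd: "\<not> int p dvd a1" "\<not> int p dvd a2"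
    by (auto simp: zdvd_not_zless)
  have "\<not> int p dvd a1 - a2"
    using range assms(4) dvd_imp_le_int[of "a1 - a2" "int p"] by auto
  moreover note tf = triangle_free_residue_ring[OF assms(7)[unfolded assms(6)] p(3)]
  have "\<not> int p dvd a1 + a2" "\<not> int p dvd a1 + a1 + a2" "\<not> int p dvd a1 + a2 + a2"
    using tf(1)[of a1 a2 a1] tf(2)[of a1 a1 a2] tf(2)[of a1 a2 a2] assms(3) by blast+
  ultimately obtain t where t: "coprime t (int p)"
      "2 * (t * a1 mod int p + t * a2 mod int p) < int p"
    using ex_small_dilation[OF p(1,2) ndvd] by blast
  have "int (beta G) \<le> t * a1 mod int p + t * a2 mod int p"
    using beta_cayley_residue_ring_le[OF p(3) t(1) ndvd] assms(3,6) by simp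
  then have "2 * int (beta G) \<le> 2 * (t * a1 mod int p + t * a2 mod int p)"
    by (intro mult_left_mono) simp_all
  with t(2) have "2 * int (beta G) < int p" by (rule order.strict_trans1[rotated])
  \<comment> \<open>Integrality sharpens the strict bound \<open>p / 2\<close> to
    \<open>(p - 1) / 2\<close>.\<close>
  then have "2 * beta G + 1 \<le> p" by linarith
  then have "real (2 * beta G + 1) \<le> real p" by (rule of_nat_mono)
  then show "real (beta G) \<le> (real p - 1) / 2" by simp
  have "p choose 2 \<le> gamma G + p * 2"
    using gamma_cayley_residue_ring_ge[of A p] assms(3,4,6) by simp
  moreover have "p * (p - 1) = 2 * (p choose 2)"
    using assms(2) by (auto simp: choose_two)
  \<comment> \<open>This is where \<open>p \<ge> 7\<close> enters the count: there are at least
    \<open>3 * p\<close> pairs, of which at most \<open>2 * p\<close> are adjacent.\<close>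
  moreover have "p * (p - 1) \<ge> p * 6" using assms(2) by (intro mult_le_mono2) simp
  ultimately have "p \<le> gamma G" by linarith
  then show "(real p - 1) / 2 \<le> real (gamma G) / 2" by simp
qed

end
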